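(* Fix $\theta\in\mathbb R$ and $\delta>0$, and suppose that $(X_n)$ are iid with a $\mathcal P$-uniformly bounded $(2+\delta)$-th moment for some $\mathcal P\subseteq\mathcal M_{2+\delta}(\theta)$. Let $\gamma\in(0,1/2)$ and let $(T_n)$ be a sequence of nonnegative reals with $T_n=o(n^{\delta\gamma/2}/\log^{2+\delta/2}n)$. For integers $k\ge m\ge2$ define $$E_k^{(m)}(\theta)=\left(\int_{\mathbb R}\exp\Big\{\lambda S_k(\theta)-k\Big(\hat s_k^2+\frac1{\log m}\Big)\frac{\lambda^2}{2}\Big\}\,dF(\lambda)\right)\wedge T_m,$$ where $F$ is any probability measure supported on a subset of $\mathbb R$. Then the upper triangular array $((E_k^{(m)}(\theta))_{k\ge m})_{m}$ is a $\mathcal P$-uniform asymptotic e-process, i.e. for any stopping time $\tau$, $$\limsup_{m\to\infty}\sup_{P\in\mathcal P}\mathbb E_P\big[E^{(m)}_{\tau\vee m}(\theta)\big]\le1.$$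
   Context: Under $P$, $X_1,X_2,\dots$ are iid with law $P$. Stopping times are $\mathbb N$-valued and taken with respect to the filtration $\mathcal F_n=\sigma(X_1,\dots,X_n)$. $S_k(\theta)=\sum_{i\le k}(X_i-\theta)$, $\overline X_k=k^{-1}\sum_{i\le k}X_i$, $\hat s_k^2=k^{-1}\sum_{i\le k}(X_i-\overline X_k)^2$, $a\wedge b=\min(a,b)$, $a\vee b=\max(a,b)$. $\mathcal M_q(\theta)$ is the set of distributions $P$ on $\mathbb R$ with mean $\theta$ and $\mathbb E_P|X_1-\theta|^q<\infty$. $\mathcal P$-uniformly bounded $q$-th moment means $\sup_{P\in\mathcal P}\mathbb E_P|X_1|^q<\infty$. *)

theory Defs
  imports "HOL-Probability.Probability" "HOL-Library.Landau_Symbols"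
begin

definition mean_moment_class :: "real \<Rightarrow> real \<Rightarrow> real measure set" where
  "mean_moment_class q \<theta> =
     {P. prob_space P \<and> sets P = sets borel \<and>
         integrable P (\<lambda>x. x) \<and> (LINT x|P. x) = \<theta> \<and>
         integrable P (\<lambda>x. \<bar>x - \<theta>\<bar> powr q)}"

definition uniformly_bounded_moment :: "real \<Rightarrow> real measure set \<Rightarrow> bool" where
  "uniformly_bounded_moment q \<P> \<longleftrightarrow>
     (SUP P\<in>\<P>. \<integral>\<^sup>+ x. ennreal (\<bar>x\<bar> powr q) \<partial>P) < \<infinity>"

text \<open>
  The observations are \<open>X 1, X 2, \<dots>\<close>; the variable \<open>X 0\<close> is never used.
\<close>

definition iid_with_law :: "'a measure \<Rightarrow> (nat \<Rightarrow> 'a \<Rightarrow> real) \<Rightarrow> real measure \<Rightarrow> bool" where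
  "iid_with_law M X P \<longleftrightarrow>
     prob_space M \<and> prob_space.indep_vars M (\<lambda>_. borel) X {1..} \<and>
     (\<forall>i\<ge>1. distr M borel (X i) = P)"

text \<open>
  \<open>\<F>\<^sub>n = \<sigma>(X 1, \<dots>, X n)\<close> on the sample space \<open>\<Omega>\<close>; \<open>\<F>\<^sub>0\<close> is the trivial \<open>\<sigma>\<close>-algebra.
\<close>

definition natural_filtration :: "'a set \<Rightarrow> (nat \<Rightarrow> 'a \<Rightarrow> real) \<Rightarrow> nat \<Rightarrow> 'a measure" where
  "natural_filtration \<Omega> X n =
     sigma \<Omega> {X i -` A \<inter> \<Omega> | i A. i \<in> {1..n} \<and> A \<in> sets borel}"

definition centered_sum :: "(nat \<Rightarrow> 'a \<Rightarrow> real) \<Rightarrow> real \<Rightarrow> nat \<Rightarrow> 'a \<Rightarrow> real" where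
  "centered_sum X \<theta> k \<omega> = (\<Sum>i=1..k. (X i \<omega> - \<theta>))"

definition sample_mean :: "(nat \<Rightarrow> 'a \<Rightarrow> real) \<Rightarrow> nat \<Rightarrow> 'a \<Rightarrow> real" where
  "sample_mean X k \<omega> = (\<Sum>i=1..k. X i \<omega>) / real k"

definition sample_var :: "(nat \<Rightarrow> 'a \<Rightarrow> real) \<Rightarrow> nat \<Rightarrow> 'a \<Rightarrow> real" where
  "sample_var X k \<omega> = (\<Sum>i=1..k. (X i \<omega> - sample_mean X k \<omega>)\<^sup>2) / real k"

text \<open>
  The mixture integral may be infinite before truncation, hence the values in \<^typ>\<open>ennreal\<close>.
  Only \<open>k \<ge> m \<ge> 2\<close> is meaningful.
\<close>

definition truncated_mixture ::
  "(nat \<Rightarrow> 'a \<Rightarrow> real) \<Rightarrow> real measure \<Rightarrow> (nat \<Rightarrow> real) \<Rightarrow> real \<Rightarrow> nat \<Rightarrow> nat \<Rightarrow> 'a \<Rightarrow> ennreal" where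
  "truncated_mixture X F T \<theta> m k \<omega> =
     min (\<integral>\<^sup>+ l. ennreal (exp (l * centered_sum X \<theta> k \<omega>
                - real k * (sample_var X k \<omega> + 1 / ln (real m)) * (l\<^sup>2 / 2))) \<partial>F)
         (ennreal (T m))"

text \<open>
  \<open>\<M> P\<close> is the probability measure on the sample space governing the data when the law is \<open>P\<close>;
  \<open>E m k\<close> is the entry of the upper triangular array in row \<open>m\<close> and column \<open>k \<ge> m\<close>. Entries
  with \<open>k < m\<close> are never evaluated.
\<close>

definition uniform_asymptotic_e_process ::
  "(nat \<Rightarrow> 'a measure) \<Rightarrow> (real measure \<Rightarrow> 'a measure) \<Rightarrow> real measure set
    \<Rightarrow> (nat \<Rightarrow> nat \<Rightarrow> 'a \<Rightarrow> ennreal) \<Rightarrow> bool" where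
  "uniform_asymptotic_e_process \<F> \<M> \<P> E \<longleftrightarrow>
     (\<forall>\<tau> :: 'a \<Rightarrow> nat. stopping_time \<F> \<tau> \<longrightarrow>
        limsup (\<lambda>m. SUP P\<in>\<P>. \<integral>\<^sup>+ \<omega>. E m (max (\<tau> \<omega>) m) \<omega> \<partial>(\<M> P)) \<le> 1)"

end

theory Submission
  imports Defs "HOL-Real_Asymp.Real_Asymp"
begin

text \<open>
  Put \<open>V\<^sub>k = (\<Sum>i\<le>k. (X\<^sub>i - \<theta>)\<^sup>2)\<close>, let \<open>v\<close> be the variance of \<open>P\<close>, and let
  \<open>W\<^sub>k = V\<^sub>k / 3 + 2 k v / 3\<close>. The inequality \<open>exp (x - x\<^sup>2 / 6) \<le> 1 + x + x\<^sup>2 / 3\<close> makes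
  \<open>exp (\<lambda> S\<^sub>k - W\<^sub>k \<lambda>\<^sup>2 / 2)\<close> a nonnegative supermartingale for every real \<open>\<lambda>\<close>, on the strength of the
  variance alone. Its mixture over any probability measure therefore has expectation at most 1 at every
  finite stopping time (\<open>stopped_mixture_le_1\<close>).

  The process in the theorem is dominated by this mixture as soon as \<open>W\<^sub>k \<le> k (s\<^sub>k\<^sup>2 + h)\<close> with
  \<open>h = 1 / ln m\<close> and \<open>s\<^sub>k\<^sup>2\<close> the sample variance. Because \<open>k s\<^sub>k\<^sup>2 = V\<^sub>k - S\<^sub>k\<^sup>2 / k\<close>, this holds unless \<open>V\<^sub>k / k\<close> falls below \<open>v - h\<close> or
  \<open>S\<^sub>k\<^sup>2\<close> exceeds a small multiple of \<open>k (1 + W\<^sub>k)\<close> (\<open>compensator_le_sample_var\<close>). The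
  probability of both decays faster than every power of \<open>k\<close>, although \<open>X\<close> has only \<open>2 + \<delta>\<close> moments. The first is a
  lower deviation of a sum of nonnegative variables, whose Laplace transform is controlled by a
  moment of order above 1 (\<open>sum_sq_lower_tail\<close>). The second is self-normalised: the supermartingale
  mixed over a standard Gaussian is \<open>exp (S\<^sub>k\<^sup>2 / (2 (1 + W\<^sub>k))) / sqrt (1 + W\<^sub>k)\<close>, so a large jump of
  \<open>X\<close> inflates \<open>W\<^sub>k\<close> along with \<open>S\<^sub>k\<^sup>2\<close> (\<open>self_normalized_tail\<close>).

  On the exceptional events the process is at most \<open>T m\<close>, which is polynomial in \<open>m\<close>. A union bound
  over \<open>k \<ge> m\<close> leaves the tail of a convergent series, and that tail depends on \<open>P\<close> only through a
  common moment bound.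
\<close>

section \<open>Elementary exponential and Gaussian estimates\<close>

text \<open>
  The constant \<open>1/6\<close> is chosen so that the derivative of \<open>ln (1 + x + x\<^sup>2/3) - x + x\<^sup>2/6\<close> has a numerator
  proportional to \<open>x\<^sup>3\<close>: lower powers cancel, and 0 is the global minimum.
\<close>
lemma exp_compensated_le_quadratic:
  fixes x :: real
  shows "exp (x - x\<^sup>2 / 6) \<le> 1 + x + x\<^sup>2 / 3"
proof -
  define q where "q = (\<lambda>x::real. 1 + x + x\<^sup>2 / 3)"
  define \<phi> where "\<phi> = (\<lambda>x. ln (q x) - x + x\<^sup>2 / 6)"
  have q_pos: "q y > 0" for y
  proof -
    \<comment> \<open>a sum of two squares that do not vanish together\<close>
    have "q y = (y / 2 + 1)\<^sup>2 + y\<^sup>2 / 12" by (simp add: q_def power2_eq_square algebra_simps)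
    moreover have "(y / 2 + 1)\<^sup>2 + y\<^sup>2 / 12 > 0"
      by (cases "y = 0") (auto intro: add_nonneg_pos)
    ultimately show ?thesis by simp
  qed
  have deriv: "(\<phi> has_real_derivative y ^ 3 / (9 * q y)) (at y)" for y
  proof -
    have dq: "(q has_real_derivative 1 + 2 * y / 3) (at y)"
      unfolding q_def by (auto intro!: derivative_eq_intros)
    have "(\<phi> has_real_derivative (1 + 2 * y / 3) / q y - 1 + y / 3) (at y)"
      unfolding \<phi>_def using q_pos[of y] by (auto intro!: derivative_eq_intros dq)
    also have "(1 + 2 * y / 3) / q y - 1 + y / 3 = y ^ 3 / (9 * q y)"
      using q_pos[of y] by (simp add: field_simps) (simp add: q_def power2_eq_square power3_eq_cube algebra_simps)
    finally show ?thesis .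
  qed
  have "\<phi> 0 \<le> \<phi> x"
  proof (cases "x \<ge> 0")
    case True
    show ?thesis
    proof (rule DERIV_nonneg_imp_nondecreasing[OF True])
      fix y :: real assume "0 \<le> y" "y \<le> x"
      then show "\<exists>d. (\<phi> has_real_derivative d) (at y) \<and> 0 \<le> d"
        using deriv[of y] q_pos[of y] by (intro exI[of _ "y ^ 3 / (9 * q y)"]) auto
    qed
  next
    case False
    then have "x \<le> 0" by simp
    then show ?thesis
    proof (rule DERIV_nonpos_imp_nonincreasing)
      fix y :: real assume "x \<le> y" "y \<le> 0"
      then have "y ^ 3 \<le> 0" by (simp add: power3_eq_cube mult_nonneg_nonpos mult_nonpos_nonpos)
      then show "\<exists>d. (\<phi> has_real_derivative d) (at y) \<and> d \<le> 0"
        using deriv[of y] q_pos[of y]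
        by (intro exI[of _ "y ^ 3 / (9 * q y)"]) (auto simp: divide_nonpos_pos)
    qed
  qed
  then have "x - x\<^sup>2 / 6 \<le> ln (q x)" by (simp add: \<phi>_def q_def)
  then have "exp (x - x\<^sup>2 / 6) \<le> exp (ln (q x))" by (simp only: exp_le_cancel_iff)
  also have "\<dots> = q x" using q_pos[of x] by simp
  finally show ?thesis by (simp add: q_def)
qed

text \<open>
  On \<open>[0, 1]\<close> the quadratic Taylor bound is even stronger, since \<open>y\<^sup>2 \<le> y powr (1 + q)\<close> there; beyond 1
  the power alone compensates \<open>- y\<close>. Integrating this bounds a Laplace transform by a moment of order
  \<open>1 + q\<close>, which may be less than 2.
\<close>
lemma exp_minus_le_powr:
  fixes y q :: real
  assumes "0 \<le> y" "0 < q" "q \<le> 1"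
  shows "exp (- y) \<le> 1 - y + y powr (1 + q)"
proof (cases "y \<le> 1")
  case True
  have "exp (- y) \<le> 1 - y + y\<^sup>2 / 2"
  proof -
    have "1 \<le> exp y * (1 - y + y\<^sup>2 / 2)"
    proof -
      have "0 \<le> (1 - y + y\<^sup>2 / 2)" using sum_power2_ge_zero[of "1-y" 1] by (simp add: power2_eq_square algebra_simps)
      moreover have "1 + y + y\<^sup>2 / 2 \<le> exp y" by (rule exp_lower_Taylor_quadratic[OF assms(1)])
      ultimately have "(1 + y + y\<^sup>2 / 2) * (1 - y + y\<^sup>2 / 2) \<le> exp y * (1 - y + y\<^sup>2 / 2)"
        by (rule mult_right_mono[rotated])
      moreover have "(1 + y + y\<^sup>2 / 2) * (1 - y + y\<^sup>2 / 2) = 1 + (y\<^sup>2)\<^sup>2 / 4"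
        by (simp add: power2_eq_square algebra_simps)
      ultimately show ?thesis by (smt (verit) zero_le_power2 divide_nonneg_pos)
    qed
    then show ?thesis by (simp add: exp_minus field_simps)
  qed
  also have "y\<^sup>2 / 2 \<le> y powr (1 + q)"
  proof (cases "y = 0")
    case False
    have "y powr 2 \<le> y powr (1 + q)" using assms True False by (intro powr_mono') auto
    moreover have "y powr 2 = y\<^sup>2" using assms by (simp add: powr_numeral)
    ultimately show ?thesis by (smt (verit) zero_le_power2 field_sum_of_halves)
  qed simp
  finally show ?thesis by simp
next
  case False
  then have "y powr 1 \<le> y powr (1 + q)" using assms by (intro powr_mono) auto
  moreover have "y powr 1 = y" using assms by simp
  moreover have "exp (- y) \<le> 1" using assms by simp
  ultimately show ?thesis by linarith
qed

text \<open>
  Completing the square: the integrand times the Gaussian density is a multiple of the normal density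
  with mean \<open>s / (1 + w)\<close> and variance \<open>1 / (1 + w)\<close>.
\<close>
lemma nn_integral_gaussian_mixture:
  fixes s w :: real
  assumes "w \<ge> 0"
  shows "(\<integral>\<^sup>+ l. ennreal (exp (l * s - w * (l\<^sup>2 / 2))) \<partial>density lborel std_normal_density)
       = ennreal (exp (s\<^sup>2 / (2 * (1 + w))) / sqrt (1 + w))"
proof -
  define c where "c = exp (s\<^sup>2 / (2 * (1 + w))) / sqrt (1 + w)"
  have pos: "1 + w > 0" using assms by simp
  have eq: "std_normal_density l * exp (l * s - w * (l\<^sup>2 / 2))
      = c * normal_density (s / (1 + w)) (1 / sqrt (1 + w)) l" for l
  proof -
    have 1: "- l\<^sup>2 / 2 + (l * s - w * (l\<^sup>2 / 2))
        = s\<^sup>2 / (2 * (1 + w)) - (l - s / (1 + w))\<^sup>2 / (2 * (1 / sqrt (1 + w))\<^sup>2)"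
    proof -
      define v a where "v = 1 + w" and "a = s / v"
      have "v > 0" "s = a * v" "w = v - 1" using pos by (auto simp: v_def a_def)
      then show ?thesis
        by (simp add: power_divide power_mult_distrib) (simp add: power2_eq_square field_simps)
    qed
    have 2: "sqrt (2 * pi * (1 / sqrt (1 + w))\<^sup>2) = sqrt (2 * pi) / sqrt (1 + w)"
      using pos by (simp add: real_sqrt_mult power_divide real_sqrt_divide)
    have "std_normal_density l * exp (l * s - w * (l\<^sup>2 / 2))
        = 1 / sqrt (2 * pi) * exp (- l\<^sup>2 / 2 + (l * s - w * (l\<^sup>2 / 2)))"
      unfolding std_normal_density_def exp_add by simp
    also have "\<dots> = c * normal_density (s / (1 + w)) (1 / sqrt (1 + w)) l"
    proof -
      have "exp (u - v) = exp u * exp (- v)" for u v :: real by (simp add: exp_diff exp_minus divide_inverse)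
      then show ?thesis unfolding 1 normal_density_def 2 c_def using pos by simp
    qed
    finally show ?thesis .
  qed
  have "c \<ge> 0" using pos by (simp add: c_def)
  have "(\<integral>\<^sup>+ l. ennreal (exp (l * s - w * (l\<^sup>2 / 2))) \<partial>density lborel std_normal_density)
      = (\<integral>\<^sup>+ l. ennreal (std_normal_density l * exp (l * s - w * (l\<^sup>2 / 2))) \<partial>lborel)"
    by (subst nn_integral_density) (auto simp: ennreal_mult)
  also have "\<dots> = (\<integral>\<^sup>+ l. ennreal c * ennreal (normal_density (s / (1 + w)) (1 / sqrt (1 + w)) l) \<partial>lborel)"
    unfolding eq using \<open>c \<ge> 0\<close> by (simp add: ennreal_mult)
  also have "\<dots> = ennreal c * (\<integral>\<^sup>+ l. ennreal (normal_density (s / (1 + w)) (1 / sqrt (1 + w)) l) \<partial>lborel)"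
    by (rule nn_integral_cmult) simp
  also have "(\<integral>\<^sup>+ l. ennreal (normal_density (s / (1 + w)) (1 / sqrt (1 + w)) l) \<partial>lborel) = 1"
    using pos by (subst nn_integral_eq_integral) (auto simp: integrable_normal_density integral_normal_density)
  finally show ?thesis by (simp add: c_def)
qed

section \<open>Optional stopping for products of independent factors\<close>

locale iid_sample =
  fixes M :: "'a measure" and X :: "nat \<Rightarrow> 'a \<Rightarrow> real" and P :: "real measure"
  assumes iid: "iid_with_law M X P"
begin

sublocale prob_space M using iid by (simp add: iid_with_law_def)

lemma indep: "indep_vars (\<lambda>_. borel) X {1..}"
  using iid by (simp add: iid_with_law_def)

lemma law: "i \<ge> 1 \<Longrightarrow> distr M borel (X i) = P"
  using iid by (auto simp: iid_with_law_def)

lemma measurable_X [measurable]: "i \<ge> 1 \<Longrightarrow> X i \<in> borel_measurable M"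
  using indep by (auto simp: indep_vars_def)

lemma nn_integral_X:
  assumes "i \<ge> 1" "f \<in> borel_measurable borel"
  shows "(\<integral>\<^sup>+ \<omega>. f (X i \<omega>) \<partial>M) = (\<integral>\<^sup>+ x. f x \<partial>P)"
  using assms by (simp add: law[OF assms(1), symmetric] nn_integral_distr)

abbreviation history :: "nat \<Rightarrow> 'a \<Rightarrow> nat \<Rightarrow> real" where
  "history n \<omega> \<equiv> restrict (\<lambda>i. X i \<omega>) {1..n}"

lemma measurable_history: "history n \<in> M \<rightarrow>\<^sub>M PiM {1..n} (\<lambda>_. borel)"
  by (intro measurable_restrict) auto

lemma space_natural_filtration: "space (natural_filtration (space M) X n) = space M"
  unfolding natural_filtration_def by (rule space_measure_of) auto

text \<open>
  Preimages under \<open>history n\<close> form a \<open>\<sigma>\<close>-algebra that contains the generators. This representation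
  reduces independence of the past from \<open>X (Suc n)\<close> to independence of two random vectors.
\<close>
lemma natural_filtration_event_of_history:
  assumes "A \<in> sets (natural_filtration (space M) X n)"
  obtains B where "B \<in> sets (PiM {1..n} (\<lambda>_. borel))" "A = history n -` B \<inter> space M"
proof -
  let ?N = "PiM {1..n} (\<lambda>_. borel :: real measure)"
  let ?V = "vimage_algebra (space M) (history n) ?N"
  have maps: "history n \<in> space M \<rightarrow> space ?N"
    by (auto simp: space_PiM)
  have "sets (natural_filtration (space M) X n)
      = sigma_sets (space M) {X i -` A \<inter> space M | i A. i \<in> {1..n} \<and> A \<in> sets borel}"
    unfolding natural_filtration_def by (rule sets_measure_of) auto
  also have "\<dots> \<subseteq> sets ?V"
  proof (rule sets.sigma_sets_subset[of _ ?V, unfolded space_vimage_algebra], safe)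
    fix i A assume iA: "i \<in> {1..n}" "A \<in> sets (borel :: real measure)"
    have "(\<lambda>z. z i) -` A \<inter> space ?N \<in> sets ?N"
      using iA by (intro measurable_sets[OF measurable_component_singleton]) auto
    moreover have "X i -` A \<inter> space M = history n -` ((\<lambda>z. z i) -` A \<inter> space ?N) \<inter> space M"
      using iA maps by auto
    ultimately show "X i -` A \<inter> space M \<in> sets ?V"
      unfolding sets_vimage_algebra2[OF maps] by blast
  qed
  finally show ?thesis using assms that unfolding sets_vimage_algebra2[OF maps] by blast
qed

lemma nn_integral_next_factor:
  assumes g [measurable]: "g \<in> borel_measurable (PiM {1..n} (\<lambda>_. borel))"
    and f [measurable]: "f \<in> borel_measurable borel"
  shows "(\<integral>\<^sup>+ \<omega>. g (history n \<omega>) * f (X (Suc n) \<omega>) \<partial>M)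
       = (\<integral>\<^sup>+ \<omega>. g (history n \<omega>) \<partial>M) * (\<integral>\<^sup>+ x. f x \<partial>P)"
proof -
  let ?N = "PiM {1..n} (\<lambda>_. borel :: real measure)"
  note [measurable] = measurable_history
  let ?N' = "PiM {Suc n} (\<lambda>_. borel :: real measure)" and ?Y = "\<lambda>\<omega>. restrict (\<lambda>i. X i \<omega>) {Suc n}"
  have Y [measurable]: "?Y \<in> M \<rightarrow>\<^sub>M ?N'" by (intro measurable_restrict) auto
  have f' [measurable]: "(\<lambda>y. f (y (Suc n))) \<in> borel_measurable ?N'"
    by (rule measurable_compose[OF _ f], rule measurable_component_singleton) simp
  have "indep_var ?N (history n) ?N' ?Y"
    by (rule indep_var_restrict[OF indep]) auto
  then have joint: "distr M ?N (history n) \<Otimes>\<^sub>M distr M ?N' ?Y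
      = distr M (?N \<Otimes>\<^sub>M ?N') (\<lambda>\<omega>. (history n \<omega>, ?Y \<omega>))"
    by (simp add: indep_var_distribution_eq)
  interpret D: prob_space "distr M ?N' ?Y" by (rule prob_space_distr) auto
  have Z: "(\<lambda>\<omega>. (history n \<omega>, ?Y \<omega>)) \<in> M \<rightarrow>\<^sub>M ?N \<Otimes>\<^sub>M ?N'"
    by (intro measurable_Pair measurable_history Y)
  have gf: "(\<lambda>z. g (fst z) * f (snd z (Suc n))) \<in> borel_measurable (?N \<Otimes>\<^sub>M ?N')"
    by (intro borel_measurable_times_ennreal measurable_compose[OF measurable_fst g]
        measurable_compose[OF measurable_snd f'])
  have gf_distr: "(\<lambda>z. g (fst z) * f (snd z (Suc n)))
      \<in> borel_measurable (distr M ?N (history n) \<Otimes>\<^sub>M distr M ?N' ?Y)"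
    using gf by (subst measurable_cong_sets[OF sets_pair_measure_cong[OF sets_distr sets_distr] refl])
  have "(\<integral>\<^sup>+ \<omega>. g (history n \<omega>) * f (X (Suc n) \<omega>) \<partial>M)
      = (\<integral>\<^sup>+ z. g (fst z) * f (snd z (Suc n)) \<partial>distr M (?N \<Otimes>\<^sub>M ?N') (\<lambda>\<omega>. (history n \<omega>, ?Y \<omega>)))"
    by (subst nn_integral_distr[OF Z]) (use gf in simp_all)
  also have "\<dots> = (\<integral>\<^sup>+ z. \<integral>\<^sup>+ y. g z * f (y (Suc n)) \<partial>distr M ?N' ?Y \<partial>distr M ?N (history n))"
    unfolding joint[symmetric] D.nn_integral_fst[OF gf_distr, symmetric] by simp
  also have "\<dots> = (\<integral>\<^sup>+ z. g z \<partial>distr M ?N (history n)) * (\<integral>\<^sup>+ y. f (y (Suc n)) \<partial>distr M ?N' ?Y)"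
    by (subst nn_integral_cmult nn_integral_multc, measurable)+
  also have "(\<integral>\<^sup>+ y. f (y (Suc n)) \<partial>distr M ?N' ?Y) = (\<integral>\<^sup>+ x. f x \<partial>P)"
    by (subst nn_integral_distr) (auto simp: nn_integral_X)
  also have "(\<integral>\<^sup>+ z. g z \<partial>distr M ?N (history n)) = (\<integral>\<^sup>+ \<omega>. g (history n \<omega>) \<partial>M)"
    by (rule nn_integral_distr[OF measurable_history]) (use g in simp)
  finally show ?thesis .
qed

lemma measurable_stopping_time_nat:
  assumes \<rho>: "stopping_time (natural_filtration (space M) X) \<rho>"
  shows "\<rho> \<in> M \<rightarrow>\<^sub>M count_space UNIV"
proof -
  have "sets (natural_filtration (space M) X n) \<subseteq> sets M" for n
    by (auto elim!: natural_filtration_event_of_history intro!: measurable_sets[OF measurable_history])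
  then have "\<rho> \<in> borel_measurable M"
    by (rule measurable_stopping_time[OF \<rho> _ space_natural_filtration])
  then show ?thesis by (simp only: measurable_cong_sets[OF refl sets_borel_eq_count_space])
qed

text \<open>
  The products form a nonnegative supermartingale. Writing \<open>G n\<close> for the \<open>n\<close>-th product, the quantity
  \<open>E[G \<rho>; \<rho> < n] + E[G n; n \<le> \<rho>]\<close> never increases with \<open>n\<close>: the event \<open>n < \<rho>\<close> depends on the first \<open>n\<close>
  observations only, so the next factor integrates out. It starts at 1, and the claim
  follows by dropping the second summand and letting \<open>n\<close> grow (monotone convergence).
\<close>
lemma stopped_product_le_1:
  fixes f :: "real \<Rightarrow> ennreal"
  assumes f [measurable]: "f \<in> borel_measurable borel" and le: "(\<integral>\<^sup>+ x. f x \<partial>P) \<le> 1"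
    and \<rho>: "stopping_time (natural_filtration (space M) X) \<rho>"
  shows "(\<integral>\<^sup>+ \<omega>. (\<Prod>i=1..\<rho> \<omega>. f (X i \<omega>)) \<partial>M) \<le> 1"
proof -
  define G where "G n \<omega> = (\<Prod>i=1..n. f (X i \<omega>))" for n \<omega>
  have G [measurable]: "G n \<in> borel_measurable M" for n
    unfolding G_def by measurable
  have step: "(\<integral>\<^sup>+ \<omega>. G (Suc n) \<omega> * indicator {\<omega>\<in>space M. Suc n \<le> \<rho> \<omega>} \<omega> \<partial>M)
       \<le> (\<integral>\<^sup>+ \<omega>. G n \<omega> * indicator {\<omega>\<in>space M. Suc n \<le> \<rho> \<omega>} \<omega> \<partial>M)" for n
  proof -
    have "{\<omega> \<in> space M. n < \<rho> \<omega>} \<in> sets (natural_filtration (space M) X n)"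
      using stopping_timeD2[OF \<rho>, of n] by (simp add: pred_def space_natural_filtration)
    then obtain B where B [measurable]: "B \<in> sets (PiM {1..n} (\<lambda>_. borel))"
      and eq: "{\<omega> \<in> space M. n < \<rho> \<omega>} = history n -` B \<inter> space M"
      by (rule natural_filtration_event_of_history)
    define g where "g z = (\<Prod>i=1..n. f (z i)) * indicator B z" for z
    have g [measurable]: "g \<in> borel_measurable (PiM {1..n} (\<lambda>_. borel))"
      unfolding g_def by measurable
    have ind: "indicator {\<omega>\<in>space M. Suc n \<le> \<rho> \<omega>} \<omega> = (indicator B (history n \<omega>) :: ennreal)"
      if "\<omega> \<in> space M" for \<omega>
      using eq that by (auto simp: indicator_def Suc_le_eq set_eq_iff)
    have gG: "g (history n \<omega>) = G n \<omega> * indicator {\<omega>\<in>space M. Suc n \<le> \<rho> \<omega>} \<omega>"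
      if "\<omega> \<in> space M" for \<omega>
      unfolding g_def G_def ind[OF that] by simp
    have "(\<integral>\<^sup>+ \<omega>. G (Suc n) \<omega> * indicator {\<omega>\<in>space M. Suc n \<le> \<rho> \<omega>} \<omega> \<partial>M)
        = (\<integral>\<^sup>+ \<omega>. g (history n \<omega>) * f (X (Suc n) \<omega>) \<partial>M)"
    proof (rule nn_integral_cong)
      fix \<omega> assume "\<omega> \<in> space M"
      moreover have "G (Suc n) \<omega> = G n \<omega> * f (X (Suc n) \<omega>)" by (simp add: G_def mult.commute)
      ultimately show "G (Suc n) \<omega> * indicator {\<omega>\<in>space M. Suc n \<le> \<rho> \<omega>} \<omega> = g (history n \<omega>) * f (X (Suc n) \<omega>)"
        by (simp only: gG mult_ac)
    qed
    also have "\<dots> = (\<integral>\<^sup>+ \<omega>. g (history n \<omega>) \<partial>M) * (\<integral>\<^sup>+ x. f x \<partial>P)"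
      by (rule nn_integral_next_factor[OF g f])
    also have "\<dots> \<le> (\<integral>\<^sup>+ \<omega>. g (history n \<omega>) \<partial>M) * 1" by (intro mult_left_mono le) auto
    also have "\<dots> = (\<integral>\<^sup>+ \<omega>. G n \<omega> * indicator {\<omega>\<in>space M. Suc n \<le> \<rho> \<omega>} \<omega> \<partial>M)"
      unfolding mult_1_right by (intro nn_integral_cong gG)
    finally show ?thesis .
  qed
  note [measurable] = measurable_stopping_time_nat[OF \<rho>]
  have partial: "(\<Sum>k<n. \<integral>\<^sup>+ \<omega>. G k \<omega> * indicator {\<omega>\<in>space M. \<rho> \<omega> = k} \<omega> \<partial>M)
      + (\<integral>\<^sup>+ \<omega>. G n \<omega> * indicator {\<omega>\<in>space M. n \<le> \<rho> \<omega>} \<omega> \<partial>M) \<le> 1" for n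
  proof (induction n)
    case 0
    then show ?case by (simp add: G_def emeasure_le_1)
  next
    case (Suc n)
    let ?eq = "\<lambda>k. \<integral>\<^sup>+ \<omega>. G k \<omega> * indicator {\<omega>\<in>space M. \<rho> \<omega> = k} \<omega> \<partial>M"
    let ?ge = "\<lambda>k j. \<integral>\<^sup>+ \<omega>. G k \<omega> * indicator {\<omega>\<in>space M. j \<le> \<rho> \<omega>} \<omega> \<partial>M"
    have split: "?eq n + ?ge n (Suc n) = ?ge n n"
      by (subst nn_integral_add[symmetric]) (auto intro!: nn_integral_cong simp: indicator_def)
    have "(\<Sum>k<Suc n. ?eq k) + ?ge (Suc n) (Suc n) = (\<Sum>k<n. ?eq k) + (?eq n + ?ge (Suc n) (Suc n))"
      by (simp add: add.assoc)
    also have "\<dots> \<le> (\<Sum>k<n. ?eq k) + (?eq n + ?ge n (Suc n))"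
      by (intro add_left_mono step)
    also have "\<dots> \<le> 1" unfolding split by (rule Suc)
    finally show ?case .
  qed
  have "(\<integral>\<^sup>+ \<omega>. G (\<rho> \<omega>) \<omega> \<partial>M)
      = (\<integral>\<^sup>+ \<omega>. (\<Sum>k. G k \<omega> * indicator {\<omega>\<in>space M. \<rho> \<omega> = k} \<omega>) \<partial>M)"
  proof (intro nn_integral_cong)
    fix \<omega> assume "\<omega> \<in> space M"
    then have "(\<lambda>k. G k \<omega> * indicator {\<omega>\<in>space M. \<rho> \<omega> = k} \<omega>) = (\<lambda>k. if k = \<rho> \<omega> then G k \<omega> else 0)"
      by (auto simp: fun_eq_iff indicator_def)
    then show "G (\<rho> \<omega>) \<omega> = (\<Sum>k. G k \<omega> * indicator {\<omega>\<in>space M. \<rho> \<omega> = k} \<omega>)"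
      using sums_single[of "\<rho> \<omega>" "\<lambda>k. G k \<omega>"] by (simp add: sums_iff)
  qed
  also have "\<dots> = (\<Sum>k. \<integral>\<^sup>+ \<omega>. G k \<omega> * indicator {\<omega>\<in>space M. \<rho> \<omega> = k} \<omega> \<partial>M)"
    by (intro nn_integral_suminf) auto
  also have "\<dots> \<le> 1"
  proof (rule suminf_le_const)
    show "(\<Sum>k<n. \<integral>\<^sup>+ \<omega>. G k \<omega> * indicator {\<omega>\<in>space M. \<rho> \<omega> = k} \<omega> \<partial>M) \<le> 1" for n
      using partial[of n] by (meson add_increasing2 le_iff_add order_trans zero_le)
  qed auto
  finally show ?thesis by (simp add: G_def)
qed

end

section \<open>The exponential supermartingale and its mixtures\<close>

locale iid_square_integrable = iid_sample +
  fixes \<theta> v :: real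
  assumes integrable_id: "integrable P (\<lambda>x. x)" and mean: "(LINT x|P. x) = \<theta>"
    and integrable_square: "integrable P (\<lambda>x. (x - \<theta>)\<^sup>2)" and variance: "(LINT x|P. (x - \<theta>)\<^sup>2) = v"
begin

lemma sets_P [measurable_cong]: "sets P = sets borel"
  using law[of 1] by auto

sublocale P: prob_space P
  using prob_space_distr[of "X 1" borel] law[of 1] by auto

lemma v_nonneg: "v \<ge> 0"
  using integral_nonneg_AE[of "\<lambda>x. (x - \<theta>)\<^sup>2" P] by (simp add: variance[symmetric])

definition sum_sq :: "nat \<Rightarrow> 'a \<Rightarrow> real" where
  "sum_sq k \<omega> = (\<Sum>i=1..k. (X i \<omega> - \<theta>)\<^sup>2)"

text \<open>
  Replaces \<open>k v\<close> in the Gaussian exponent. Mixing the empirical and the true second moment in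
  proportion 1 to 2 is what \<open>exp_compensated_le_quadratic\<close> affords.
\<close>
definition compensator :: "nat \<Rightarrow> 'a \<Rightarrow> real" where
  "compensator k \<omega> = sum_sq k \<omega> / 3 + 2 * real k * v / 3"

lemma measurable_statistics [measurable]:
  "centered_sum X \<theta> k \<in> borel_measurable M" "sum_sq k \<in> borel_measurable M"
  "compensator k \<in> borel_measurable M"
proof -
  show *: "centered_sum X \<theta> k \<in> borel_measurable M" "sum_sq k \<in> borel_measurable M"
    unfolding centered_sum_def [abs_def] sum_sq_def [abs_def] by measurable
  show "compensator k \<in> borel_measurable M"
    unfolding compensator_def [abs_def] using * by measurable
qed

lemma compensator_nonneg: "compensator k \<omega> \<ge> 0"
  by (simp add: compensator_def sum_sq_def sum_nonneg v_nonneg)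

definition factor :: "real \<Rightarrow> real \<Rightarrow> ennreal" where
  "factor l x = ennreal (exp (l * (x - \<theta>) - ((x - \<theta>)\<^sup>2 / 3 + 2 * v / 3) * (l\<^sup>2 / 2)))"

lemma measurable_factor [measurable]: "factor l \<in> borel_measurable borel"
  unfolding factor_def [abs_def] by measurable

text \<open>
  With \<open>u = l (x - \<theta>)\<close> the factor is \<open>exp (u - u\<^sup>2/6)\<close> times \<open>exp (- l\<^sup>2 v / 3)\<close>. The first has expectation
  at most \<open>1 + l\<^sup>2 v / 3\<close>, as the linear term is centred, and the second absorbs it.
\<close>
lemma nn_integral_factor_le_1: "(\<integral>\<^sup>+ x. factor l x \<partial>P) \<le> 1"
proof -
  have int: "integrable P (\<lambda>x. 1 + l * (x - \<theta>) + l\<^sup>2 / 3 * (x - \<theta>)\<^sup>2)"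
    using integrable_id integrable_square by simp
  have "factor l x \<le> ennreal (exp (- (l\<^sup>2 * v / 3)) * (1 + l * (x - \<theta>) + l\<^sup>2 / 3 * (x - \<theta>)\<^sup>2))" for x
  proof -
    have "l * (x - \<theta>) - ((x - \<theta>)\<^sup>2 / 3 + 2 * v / 3) * (l\<^sup>2 / 2)
        = - (l\<^sup>2 * v / 3) + (l * (x - \<theta>) - (l * (x - \<theta>))\<^sup>2 / 6)"
      unfolding power_mult_distrib by (simp add: field_simps)
    then have "exp (l * (x - \<theta>) - ((x - \<theta>)\<^sup>2 / 3 + 2 * v / 3) * (l\<^sup>2 / 2))
        = exp (- (l\<^sup>2 * v / 3)) * exp (l * (x - \<theta>) - (l * (x - \<theta>))\<^sup>2 / 6)"
      by (simp only: exp_add)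
    also have "\<dots> \<le> exp (- (l\<^sup>2 * v / 3)) * (1 + l * (x - \<theta>) + (l * (x - \<theta>))\<^sup>2 / 3)"
      by (intro mult_left_mono exp_compensated_le_quadratic) auto
    also have "(l * (x - \<theta>))\<^sup>2 / 3 = l\<^sup>2 / 3 * (x - \<theta>)\<^sup>2"
      unfolding power_mult_distrib by simp
    finally show ?thesis unfolding factor_def by (rule ennreal_leI)
  qed
  then have "(\<integral>\<^sup>+ x. factor l x \<partial>P)
      \<le> (\<integral>\<^sup>+ x. ennreal (exp (- (l\<^sup>2 * v / 3)) * (1 + l * (x - \<theta>) + l\<^sup>2 / 3 * (x - \<theta>)\<^sup>2)) \<partial>P)"
    by (intro nn_integral_mono)
  also have "\<dots> = ennreal (LINT x|P. exp (- (l\<^sup>2 * v / 3)) * (1 + l * (x - \<theta>) + l\<^sup>2 / 3 * (x - \<theta>)\<^sup>2))"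
  proof (rule nn_integral_eq_integral)
    have "0 \<le> 1 + l * (x - \<theta>) + l\<^sup>2 / 3 * (x - \<theta>)\<^sup>2" for x
      using order_trans[OF exp_ge_zero exp_compensated_le_quadratic[of "l * (x - \<theta>)"]]
      unfolding power_mult_distrib by simp
    then show "AE x in P. 0 \<le> exp (- (l\<^sup>2 * v / 3)) * (1 + l * (x - \<theta>) + l\<^sup>2 / 3 * (x - \<theta>)\<^sup>2)"
      by simp
  qed (use int in simp)
  also have "\<dots> \<le> ennreal 1"
  proof (rule ennreal_leI)
    have "(LINT x|P. exp (- (l\<^sup>2 * v / 3)) * (1 + l * (x - \<theta>) + l\<^sup>2 / 3 * (x - \<theta>)\<^sup>2))
        = exp (- (l\<^sup>2 * v / 3)) * (1 + l\<^sup>2 * v / 3)"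
      using integrable_id integrable_square by (simp add: mean variance P.prob_space)
    also have "\<dots> \<le> 1"
      using exp_ge_add_one_self[of "l\<^sup>2 * v / 3"] by (simp add: exp_minus field_simps)
    finally show "(LINT x|P. exp (- (l\<^sup>2 * v / 3)) * (1 + l * (x - \<theta>) + l\<^sup>2 / 3 * (x - \<theta>)\<^sup>2)) \<le> 1" .
  qed
  finally show ?thesis by simp
qed

lemma compensator_eq_sum: "compensator k \<omega> = (\<Sum>i=1..k. (X i \<omega> - \<theta>)\<^sup>2 / 3 + 2 * v / 3)"
  by (simp add: compensator_def sum_sq_def sum.distrib sum_divide_distrib)

lemma prod_factor:
  "(\<Prod>i=1..k. factor l (X i \<omega>)) = ennreal (exp (l * centered_sum X \<theta> k \<omega> - compensator k \<omega> * (l\<^sup>2 / 2)))"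
proof -
  have "(\<Prod>i=1..k. factor l (X i \<omega>))
      = ennreal (exp (\<Sum>i=1..k. l * (X i \<omega> - \<theta>) - ((X i \<omega> - \<theta>)\<^sup>2 / 3 + 2 * v / 3) * (l\<^sup>2 / 2)))"
    unfolding factor_def by (simp add: prod_ennreal exp_sum)
  also have "(\<Sum>i=1..k. l * (X i \<omega> - \<theta>) - ((X i \<omega> - \<theta>)\<^sup>2 / 3 + 2 * v / 3) * (l\<^sup>2 / 2))
      = l * centered_sum X \<theta> k \<omega> - compensator k \<omega> * (l\<^sup>2 / 2)"
  proof -
    show ?thesis
      by (simp only: sum_subtractf centered_sum_def sum_distrib_left[symmetric] sum_distrib_right[symmetric]
          compensator_eq_sum)
  qed
  finally show ?thesis .
qed

lemma stopped_mixture_le_1: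
  assumes "prob_space F" and [measurable_cong]: "sets F = sets borel"
    and \<rho>: "stopping_time (natural_filtration (space M) X) \<rho>"
  shows "(\<integral>\<^sup>+ \<omega>. \<integral>\<^sup>+ l. ennreal (exp (l * centered_sum X \<theta> (\<rho> \<omega>) \<omega>
            - compensator (\<rho> \<omega>) \<omega> * (l\<^sup>2 / 2))) \<partial>F \<partial>M) \<le> 1"
proof -
  interpret F: prob_space F by fact
  interpret FM: pair_sigma_finite F M ..
  note [measurable] = measurable_stopping_time_nat[OF \<rho>]
  have [measurable]: "(\<lambda>\<omega>. centered_sum X \<theta> (\<rho> \<omega>) \<omega>) \<in> borel_measurable M"
    "(\<lambda>\<omega>. compensator (\<rho> \<omega>) \<omega>) \<in> borel_measurable M"
    by (rule measurable_compose_countable; measurable)+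
  have "(\<integral>\<^sup>+ \<omega>. \<integral>\<^sup>+ l. ennreal (exp (l * centered_sum X \<theta> (\<rho> \<omega>) \<omega>
            - compensator (\<rho> \<omega>) \<omega> * (l\<^sup>2 / 2))) \<partial>F \<partial>M)
      = (\<integral>\<^sup>+ l. \<integral>\<^sup>+ \<omega>. ennreal (exp (l * centered_sum X \<theta> (\<rho> \<omega>) \<omega>
            - compensator (\<rho> \<omega>) \<omega> * (l\<^sup>2 / 2))) \<partial>M \<partial>F)"
    by (rule FM.Fubini') measurable
  also have "\<dots> \<le> (\<integral>\<^sup>+ l. 1 \<partial>F)"
    unfolding prod_factor[symmetric]
    by (intro nn_integral_mono stopped_product_le_1 nn_integral_factor_le_1 \<rho>) measurable
  also have "\<dots> = 1" by (simp add: F.emeasure_space_1)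
  finally show ?thesis .
qed

section \<open>Probabilities of the exceptional events\<close>

lemma nn_integral_compensator: "(\<integral>\<^sup>+ \<omega>. ennreal (compensator k \<omega>) \<partial>M) = ennreal (real k * v)"
proof -
  have "(\<integral>\<^sup>+ \<omega>. ennreal (compensator k \<omega>) \<partial>M)
      = (\<integral>\<^sup>+ \<omega>. (\<Sum>i=1..k. ennreal ((X i \<omega> - \<theta>)\<^sup>2 / 3 + 2 * v / 3)) \<partial>M)"
    unfolding compensator_eq_sum by (intro nn_integral_cong) (simp add: v_nonneg sum_ennreal del: ennreal_plus)
  also have "\<dots> = (\<Sum>i=1..k. \<integral>\<^sup>+ \<omega>. ennreal ((X i \<omega> - \<theta>)\<^sup>2 / 3 + 2 * v / 3) \<partial>M)"
    by (rule nn_integral_sum) measurable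
  also have "\<dots> = (\<Sum>i=1..k. \<integral>\<^sup>+ x. ennreal ((x - \<theta>)\<^sup>2 / 3 + 2 * v / 3) \<partial>P)"
    by (intro sum.cong refl nn_integral_X) auto
  also have "(\<integral>\<^sup>+ x. ennreal ((x - \<theta>)\<^sup>2 / 3 + 2 * v / 3) \<partial>P) = ennreal v"
    using integrable_square v_nonneg
    by (subst nn_integral_eq_integral) (auto simp: variance P.prob_space)
  finally show ?thesis by (simp add: ennreal_mult v_nonneg ennreal_of_nat_eq_real_of_nat)
qed

text \<open>
  The Gaussian mixture \<open>G\<close> controls \<open>exp (S\<^sup>2 / (2 w))\<close> only up to the random factor \<open>sqrt w\<close>, where
  \<open>w = 1 + compensator k\<close>. Halving the exponent and using the inequality between arithmetic and
  geometric means gives \<open>2 exp (S\<^sup>2 / (4 w)) \<le> G + sqrt w \<le> G + w\<close>, and the expectation of the right-hand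
  side is at most \<open>2 + k v\<close>.
\<close>
lemma self_normalized_tail:
  "emeasure M {\<omega> \<in> space M. \<eta> * real k * (1 + compensator k \<omega>) < (centered_sum X \<theta> k \<omega>)\<^sup>2}
    \<le> ennreal ((1 + real k * v) * exp (- (\<eta> * real k / 4)))"
proof -
  let ?A = "{\<omega> \<in> space M. \<eta> * real k * (1 + compensator k \<omega>) < (centered_sum X \<theta> k \<omega>)\<^sup>2}"
  define G where "G \<omega> = exp ((centered_sum X \<theta> k \<omega>)\<^sup>2 / (2 * (1 + compensator k \<omega>))) / sqrt (1 + compensator k \<omega>)" for \<omega>
  have G_nonneg: "G \<omega> \<ge> 0" for \<omega> using compensator_nonneg by (simp add: G_def)
  have [measurable]: "G \<in> borel_measurable M" unfolding G_def [abs_def] by measurable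
  have EG: "(\<integral>\<^sup>+ \<omega>. ennreal (G \<omega>) \<partial>M) \<le> 1"
  proof -
    have "ennreal (G \<omega>) = (\<integral>\<^sup>+ l. ennreal (exp (l * centered_sum X \<theta> k \<omega>
            - compensator k \<omega> * (l\<^sup>2 / 2))) \<partial>density lborel std_normal_density)" for \<omega>
      unfolding G_def by (rule nn_integral_gaussian_mixture[OF compensator_nonneg, symmetric])
    then show ?thesis
      using stopped_mixture_le_1[OF prob_space_normal_density _ stopping_time_const, of 1 0 k] by simp
  qed
  have ind: "indicator ?A \<omega> \<le> ennreal (exp (- (\<eta> * real k / 4)) / 2) * (ennreal (G \<omega>) + 1 + ennreal (compensator k \<omega>))" for \<omega>
  proof (cases "\<omega> \<in> ?A")
    case True
    define w where "w = 1 + compensator k \<omega>"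
    define a where "a = exp ((centered_sum X \<theta> k \<omega>)\<^sup>2 / (4 * w))"
    have w: "w \<ge> 1" using compensator_nonneg by (simp add: w_def)
    have "a\<^sup>2 = exp ((centered_sum X \<theta> k \<omega>)\<^sup>2 / (2 * w))"
      by (simp add: a_def exp_double[symmetric])
    then have G: "G \<omega> = a\<^sup>2 / sqrt w" by (simp add: G_def w_def)
    have "0 \<le> (a - sqrt w)\<^sup>2 / sqrt w" using w by simp
    also have "\<dots> = G \<omega> - 2 * a + sqrt w"
      using w by (simp add: G power2_diff field_simps)
    finally have "2 * a \<le> G \<omega> + sqrt w" by simp
    also have "sqrt w \<le> w" by (rule real_le_lsqrt) (use w self_le_power[of w 2] in auto)
    finally have a: "a \<le> (G \<omega> + w) / 2" by simp
    have "\<eta> * real k \<le> (centered_sum X \<theta> k \<omega>)\<^sup>2 / w"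
      using True w by (simp add: w_def field_simps)
    then have "exp (\<eta> * real k / 4) \<le> a" by (simp add: a_def)
    with a have "exp (\<eta> * real k / 4) \<le> (G \<omega> + w) / 2" by linarith
    then have "1 \<le> exp (- (\<eta> * real k / 4)) / 2 * (G \<omega> + 1 + compensator k \<omega>)"
      by (simp add: exp_minus field_simps w_def)
    then have "ennreal 1 \<le> ennreal (exp (- (\<eta> * real k / 4)) / 2 * (G \<omega> + 1 + compensator k \<omega>))"
      by (rule ennreal_leI)
    also have "\<dots> = ennreal (exp (- (\<eta> * real k / 4)) / 2) * (ennreal (G \<omega>) + 1 + ennreal (compensator k \<omega>))"
      using G_nonneg compensator_nonneg
      by (simp only: ennreal_mult ennreal_plus ennreal_1 add_nonneg_nonneg zero_le_one exp_ge_zero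
          divide_nonneg_nonneg zero_le_numeral)
    finally show ?thesis using True by simp
  qed simp
  have "emeasure M ?A = (\<integral>\<^sup>+ \<omega>. indicator ?A \<omega> \<partial>M)" by simp
  also have "\<dots> \<le> (\<integral>\<^sup>+ \<omega>. ennreal (exp (- (\<eta> * real k / 4)) / 2) * (ennreal (G \<omega>) + 1 + ennreal (compensator k \<omega>)) \<partial>M)"
    by (intro nn_integral_mono ind)
  also have "\<dots> = ennreal (exp (- (\<eta> * real k / 4)) / 2) * ((\<integral>\<^sup>+ \<omega>. ennreal (G \<omega>) \<partial>M) + 1 + ennreal (real k * v))"
    by (simp add: nn_integral_cmult nn_integral_add nn_integral_compensator emeasure_space_1)
  also have "\<dots> \<le> ennreal (exp (- (\<eta> * real k / 4)) / 2) * (1 + 1 + ennreal (real k * v))"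
    by (intro mult_left_mono add_right_mono EG) auto
  also have "\<dots> = ennreal (exp (- (\<eta> * real k / 4)) / 2 * (2 + real k * v))"
    using v_nonneg
    by (subst ennreal_mult, simp, simp) simp
  also have "\<dots> \<le> ennreal ((1 + real k * v) * exp (- (\<eta> * real k / 4)))"
    using v_nonneg by (intro ennreal_leI) (simp add: field_simps)
  finally show ?thesis .
qed

text \<open>
  The Chernoff bound for \<open>- V\<^sub>k\<close> at rate \<open>s\<close>. As the summands are nonnegative, their Laplace transform
  is finite at every rate, and a moment of order \<open>1 + q\<close> bounds its second term.
\<close>
lemma sum_sq_lower_tail:
  assumes s: "0 \<le> s" and q: "0 < q" "q \<le> 1"
    and int: "integrable P (\<lambda>x. ((x - \<theta>)\<^sup>2) powr (1 + q))"
    and B: "(LINT x|P. ((x - \<theta>)\<^sup>2) powr (1 + q)) \<le> B"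
  shows "emeasure M {\<omega> \<in> space M. sum_sq k \<omega> < real k * (v - \<epsilon>)}
    \<le> ennreal (exp (- (real k * (s * \<epsilon> - s powr (1 + q) * B))))"
proof -
  let ?A = "{\<omega> \<in> space M. sum_sq k \<omega> < real k * (v - \<epsilon>)}"
  \<comment> \<open>normalised so that the factor \<open>exp (c - s (x - \<theta>)\<^sup>2)\<close> has expectation at most 1\<close>
  define c where "c = s * v - s powr (1 + q) * B"
  define f where "f x = ennreal (exp (c - s * (x - \<theta>)\<^sup>2))" for x
  have f [measurable]: "f \<in> borel_measurable borel" unfolding f_def [abs_def] by measurable
  have f_le: "(\<integral>\<^sup>+ x. f x \<partial>P) \<le> 1"
  proof -
    let ?h = "\<lambda>x. 1 - s * (x - \<theta>)\<^sup>2 + s powr (1 + q) * ((x - \<theta>)\<^sup>2) powr (1 + q)"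
    have h: "exp (- (s * (x - \<theta>)\<^sup>2)) \<le> ?h x" for x
      using exp_minus_le_powr[of "s * (x - \<theta>)\<^sup>2" q] s q by (simp add: powr_mult)
    then have h_nonneg: "0 \<le> ?h x" for x
      using order_trans[OF exp_ge_zero] by blast
    have "(\<integral>\<^sup>+ x. f x \<partial>P) \<le> (\<integral>\<^sup>+ x. ennreal (exp c * ?h x) \<partial>P)"
      unfolding f_def diff_conv_add_uminus exp_add
      by (intro nn_integral_mono ennreal_leI mult_left_mono) (use h in auto)
    also have "\<dots> = ennreal (LINT x|P. exp c * ?h x)"
      using int integrable_square h_nonneg by (intro nn_integral_eq_integral) (auto simp del: mult_minus_right)
    also have "\<dots> \<le> ennreal 1"
    proof (rule ennreal_leI)
      have "(LINT x|P. exp c * ?h x)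
          = exp c * (1 - s * v + s powr (1 + q) * (LINT x|P. ((x - \<theta>)\<^sup>2) powr (1 + q)))"
        using int integrable_square by (simp add: variance P.prob_space)
      also have "\<dots> \<le> exp c * (1 - c)"
        using B by (intro mult_left_mono) (auto simp: c_def intro!: mult_left_mono)
      also have "\<dots> \<le> exp c * exp (- c)"
        using exp_ge_add_one_self[of "- c"] by (intro mult_left_mono) auto
      also have "\<dots> = 1" by (simp add: exp_minus)
      finally show "(LINT x|P. exp c * ?h x) \<le> 1" .
    qed
    finally show ?thesis by simp
  qed
  have prod: "(\<Prod>i=1..k. f (X i \<omega>)) = ennreal (exp (real k * c - s * sum_sq k \<omega>))" for \<omega>
    unfolding f_def sum_sq_def
    by (simp add: prod_ennreal exp_sum[symmetric] sum_subtractf sum_distrib_left)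
  have ind: "indicator ?A \<omega> \<le> ennreal (exp (- (real k * (s * \<epsilon> - s powr (1 + q) * B)))) * (\<Prod>i=1..k. f (X i \<omega>))" for \<omega>
  proof (cases "\<omega> \<in> ?A")
    case True
    then have "s * sum_sq k \<omega> \<le> s * (real k * (v - \<epsilon>))"
      using s by (intro mult_left_mono) auto
    then have "0 \<le> - (real k * (s * \<epsilon> - s powr (1 + q) * B)) + (real k * c - s * sum_sq k \<omega>)"
      by (simp add: c_def algebra_simps)
    then have "1 \<le> exp (- (real k * (s * \<epsilon> - s powr (1 + q) * B)) + (real k * c - s * sum_sq k \<omega>))" by simp
    then have "ennreal 1 \<le> ennreal (exp (- (real k * (s * \<epsilon> - s powr (1 + q) * B))) * exp (real k * c - s * sum_sq k \<omega>))"
      unfolding exp_add by (rule ennreal_leI)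
    then show ?thesis using True unfolding prod by (simp add: ennreal_mult)
  qed simp
  have "emeasure M ?A = (\<integral>\<^sup>+ \<omega>. indicator ?A \<omega> \<partial>M)" by simp
  also have "\<dots> \<le> (\<integral>\<^sup>+ \<omega>. ennreal (exp (- (real k * (s * \<epsilon> - s powr (1 + q) * B)))) * (\<Prod>i=1..k. f (X i \<omega>)) \<partial>M)"
    by (intro nn_integral_mono ind)
  also have "\<dots> = ennreal (exp (- (real k * (s * \<epsilon> - s powr (1 + q) * B)))) * (\<integral>\<^sup>+ \<omega>. (\<Prod>i=1..k. f (X i \<omega>)) \<partial>M)"
    by (rule nn_integral_cmult) measurable
  also have "\<dots> \<le> ennreal (exp (- (real k * (s * \<epsilon> - s powr (1 + q) * B)))) * 1"
    using stopped_product_le_1[OF f f_le stopping_time_const] by (intro mult_left_mono) auto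
  finally show ?thesis by simp
qed

section \<open>Comparison with the empirical variance\<close>

lemma sample_var_eq:
  assumes "k \<ge> 1"
  shows "real k * sample_var X k \<omega> = sum_sq k \<omega> - (centered_sum X \<theta> k \<omega>)\<^sup>2 / real k"
proof -
  define d where "d = centered_sum X \<theta> k \<omega> / real k"
  have S: "(\<Sum>i=1..k. X i \<omega> - \<theta>) = real k * d" using assms by (simp add: d_def centered_sum_def)
  have "sample_mean X k \<omega> = \<theta> + d"
    using S assms by (simp add: sample_mean_def sum_subtractf field_simps)
  then have "real k * sample_var X k \<omega> = (\<Sum>i=1..k. ((X i \<omega> - \<theta>) - d)\<^sup>2)"
    using assms by (simp add: sample_var_def diff_diff_eq)
  also have "\<dots> = (\<Sum>i=1..k. (X i \<omega> - \<theta>)\<^sup>2 + d\<^sup>2 - 2 * d * (X i \<omega> - \<theta>))"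
    by (intro sum.cong refl) (simp add: power2_diff)
  also have "\<dots> = sum_sq k \<omega> + real k * d\<^sup>2 - 2 * d * (\<Sum>i=1..k. X i \<omega> - \<theta>)"
    unfolding sum_subtractf[of "\<lambda>i. (X i \<omega> - \<theta>)\<^sup>2 + d\<^sup>2"] sum.distrib sum_distrib_left[symmetric] sum_sq_def by simp
  also have "\<dots> = sum_sq k \<omega> - real k * d\<^sup>2" unfolding S by (simp add: power2_eq_square)
  also have "real k * d\<^sup>2 = (centered_sum X \<theta> k \<omega>)\<^sup>2 / real k"
    using assms by (simp add: d_def power2_eq_square)
  finally show ?thesis .
qed

text \<open>
  The difference \<open>V\<^sub>k - W\<^sub>k\<close> is \<open>2 (V\<^sub>k - k v) / 3 \<ge> - 2 k h / 3\<close>, so the regularisation \<open>k h\<close> leaves a slack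
  of \<open>k h / 3\<close>. It pays for \<open>S\<^sub>k\<^sup>2 / k\<close>, at most \<open>\<eta> (1 + W\<^sub>k)\<close>, which is \<open>\<eta> (1 + k v)\<close> when \<open>V\<^sub>k = k v\<close>;
  hence the condition \<open>\<eta> (v + 1) \<le> h / 3\<close>. A larger \<open>V\<^sub>k\<close> only widens the margin, by \<open>\<eta> \<le> 2\<close>.
\<close>
lemma compensator_le_sample_var:
  assumes k: "k \<ge> 1" and \<eta>: "0 \<le> \<eta>" "\<eta> \<le> 2" "\<eta> * (v + 1) \<le> h / 3" and h: "0 \<le> h"
    and S: "(centered_sum X \<theta> k \<omega>)\<^sup>2 \<le> \<eta> * real k * (1 + compensator k \<omega>)"
    and V: "real k * (v - h) \<le> sum_sq k \<omega>"
  shows "compensator k \<omega> \<le> real k * (sample_var X k \<omega> + h)"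
proof -
  let ?n = "real k" and ?V = "sum_sq k \<omega>"
  have n: "?n \<ge> 1" using k by simp
  have "(centered_sum X \<theta> k \<omega>)\<^sup>2 / ?n \<le> \<eta> * (1 + compensator k \<omega>)"
    using S n by (simp add: field_simps)
  moreover have "compensator k \<omega> + \<eta> * (1 + compensator k \<omega>) \<le> ?V + ?n * h"
  proof -
    have "(2 - \<eta>) / 3 * (?n * (v - h)) \<le> (2 - \<eta>) / 3 * ?V"
      using \<eta> by (intro mult_left_mono V) auto
    moreover have "?n * (\<eta> * (v + 1)) \<le> ?n * (h / 3)" using \<eta> by (intro mult_left_mono) auto
    moreover have "\<eta> * 1 \<le> \<eta> * ?n" using \<eta> n by (intro mult_left_mono) auto
    moreover have "0 \<le> \<eta> * (?n * h)" using \<eta> h by simp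
    ultimately show ?thesis unfolding compensator_def by (simp add: field_simps)
  qed
  ultimately show ?thesis using sample_var_eq[OF k, of \<omega>] by (simp add: distrib_left)
qed

text \<open>
  Off the exceptional events at time \<open>max \<tau> m\<close> the process is below the stopped mixture. On them it is
  at most \<open>T m\<close>; the value of the time being random, all \<open>k \<ge> m\<close> enter a union bound.
\<close>
lemma nn_integral_truncated_mixture_le:
  assumes F: "prob_space F" and [measurable_cong]: "sets F = sets borel"
    and \<tau>: "stopping_time (natural_filtration (space M) X) \<tau>"
    and m: "m \<ge> 1" and h: "h = 1 / ln (real m)" "0 \<le> h"
    and \<eta>: "0 \<le> \<eta>" "\<eta> \<le> 2" "\<eta> * (v + 1) \<le> h / 3"
    and s: "0 \<le> s" and q: "0 < q" "q \<le> 1"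
    and int: "integrable P (\<lambda>x. ((x - \<theta>)\<^sup>2) powr (1 + q))"
    and B: "(LINT x|P. ((x - \<theta>)\<^sup>2) powr (1 + q)) \<le> B"
  shows "(\<integral>\<^sup>+ \<omega>. truncated_mixture X F T \<theta> m (max (\<tau> \<omega>) m) \<omega> \<partial>M)
    \<le> 1 + ennreal (T m) * (\<Sum>k. ennreal ((1 + real (k + m) * v) * exp (- (\<eta> * real (k + m) / 4))
          + exp (- (real (k + m) * (s * h - s powr (1 + q) * B)))))"
proof -
  interpret F: prob_space F by fact
  define \<rho> where "\<rho> \<omega> = max (\<tau> \<omega>) m" for \<omega>
  have \<rho>: "stopping_time (natural_filtration (space M) X) \<rho>"
    unfolding \<rho>_def [abs_def] by (intro stopping_time_max \<tau> stopping_time_const)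
  note [measurable] = measurable_stopping_time_nat[OF \<rho>]
  have [measurable]: "(\<lambda>\<omega>. centered_sum X \<theta> (\<rho> \<omega>) \<omega>) \<in> borel_measurable M"
    "(\<lambda>\<omega>. compensator (\<rho> \<omega>) \<omega>) \<in> borel_measurable M"
    by (rule measurable_compose_countable; measurable)+
  define N where "N \<omega> = (\<integral>\<^sup>+ l. ennreal (exp (l * centered_sum X \<theta> (\<rho> \<omega>) \<omega>
            - compensator (\<rho> \<omega>) \<omega> * (l\<^sup>2 / 2))) \<partial>F)" for \<omega>
  have N [measurable]: "N \<in> borel_measurable M" unfolding N_def [abs_def] by measurable
  define U where "U k = {\<omega> \<in> space M. \<eta> * real k * (1 + compensator k \<omega>) < (centered_sum X \<theta> k \<omega>)\<^sup>2}" for k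
  define L where "L k = {\<omega> \<in> space M. sum_sq k \<omega> < real k * (v - h)}" for k
  have [measurable]: "U k \<in> sets M" "L k \<in> sets M" for k
    unfolding U_def L_def by measurable
  have le: "truncated_mixture X F T \<theta> m (\<rho> \<omega>) \<omega>
      \<le> N \<omega> + ennreal (T m) * (\<Sum>k. indicator (U (k + m)) \<omega> + indicator (L (k + m)) \<omega>)"
    if \<omega>: "\<omega> \<in> space M" for \<omega>
  proof (cases "\<omega> \<in> U (\<rho> \<omega>) \<union> L (\<rho> \<omega>)")
    case True
    obtain j where j: "\<rho> \<omega> = j + m" using le_Suc_ex[of m "\<rho> \<omega>"] by (auto simp: \<rho>_def add.commute)
    have "(1::ennreal) \<le> indicator (U (j + m)) \<omega> + indicator (L (j + m)) \<omega>"
      using True by (auto simp: j)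
    also have "\<dots> \<le> (\<Sum>k. indicator (U (k + m)) \<omega> + indicator (L (k + m)) \<omega>)"
      using sum_le_suminf[of "\<lambda>k. indicator (U (k + m)) \<omega> + indicator (L (k + m)) \<omega> :: ennreal" "{j}"] by simp
    finally have *: "ennreal (T m) * 1
        \<le> ennreal (T m) * (\<Sum>k. indicator (U (k + m)) \<omega> + indicator (L (k + m)) \<omega>)"
      by (rule mult_left_mono) simp
    have "truncated_mixture X F T \<theta> m (\<rho> \<omega>) \<omega> \<le> ennreal (T m) * 1"
      by (simp add: truncated_mixture_def)
    also note *
    also have "ennreal (T m) * (\<Sum>k. indicator (U (k + m)) \<omega> + indicator (L (k + m)) \<omega>)
        \<le> N \<omega> + ennreal (T m) * (\<Sum>k. indicator (U (k + m)) \<omega> + indicator (L (k + m)) \<omega>)"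
      by (rule add_increasing) auto
    finally show ?thesis .
  next
    case False
    have "compensator (\<rho> \<omega>) \<omega> \<le> real (\<rho> \<omega>) * (sample_var X (\<rho> \<omega>) \<omega> + h)"
      using False \<omega> m by (intro compensator_le_sample_var[where \<eta> = \<eta>] \<eta> h) (auto simp: U_def L_def \<rho>_def not_less)
    then have "truncated_mixture X F T \<theta> m (\<rho> \<omega>) \<omega> \<le> N \<omega>"
      unfolding truncated_mixture_def N_def h(1)
      by (intro min.coboundedI1 nn_integral_mono ennreal_leI)
        (auto intro!: mult_right_mono)
    then show ?thesis by (rule order_trans) simp
  qed
  have "(\<integral>\<^sup>+ \<omega>. truncated_mixture X F T \<theta> m (\<rho> \<omega>) \<omega> \<partial>M)
      \<le> (\<integral>\<^sup>+ \<omega>. N \<omega> + ennreal (T m) * (\<Sum>k. indicator (U (k + m)) \<omega> + indicator (L (k + m)) \<omega>) \<partial>M)"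
    by (intro nn_integral_mono le)
  also have "\<dots> = (\<integral>\<^sup>+ \<omega>. N \<omega> \<partial>M) + ennreal (T m) * (\<Sum>k. emeasure M (U (k + m)) + emeasure M (L (k + m)))"
    by (simp add: nn_integral_add nn_integral_cmult nn_integral_suminf)
  also have "\<dots> \<le> 1 + ennreal (T m) * (\<Sum>k. ennreal ((1 + real (k + m) * v) * exp (- (\<eta> * real (k + m) / 4))
          + exp (- (real (k + m) * (s * h - s powr (1 + q) * B)))))"
  proof (intro add_mono mult_left_mono suminf_le)
    show "(\<integral>\<^sup>+ \<omega>. N \<omega> \<partial>M) \<le> 1"
      unfolding N_def by (rule stopped_mixture_le_1[OF F _ \<rho>]) fact
    fix k
    have "emeasure M (U (k + m)) + emeasure M (L (k + m))
        \<le> ennreal ((1 + real (k + m) * v) * exp (- (\<eta> * real (k + m) / 4)))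
          + ennreal (exp (- (real (k + m) * (s * h - s powr (1 + q) * B))))"
      unfolding U_def L_def by (intro add_mono self_normalized_tail sum_sq_lower_tail s q int B)
    also have "\<dots> = ennreal ((1 + real (k + m) * v) * exp (- (\<eta> * real (k + m) / 4))
          + exp (- (real (k + m) * (s * h - s powr (1 + q) * B))))"
      using v_nonneg by (subst ennreal_plus) auto
    finally show "emeasure M (U (k + m)) + emeasure M (L (k + m))
        \<le> ennreal ((1 + real (k + m) * v) * exp (- (\<eta> * real (k + m) / 4))
          + exp (- (real (k + m) * (s * h - s powr (1 + q) * B))))" .
  qed auto
  finally show ?thesis by (simp add: \<rho>_def)
qed

end

section \<open>Uniformity and asymptotics\<close>

text \<open>
  Bounds the probability of the two exceptional events at time \<open>k\<close>, for every large row \<open>m \<le> k\<close> and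
  every law with moments bounded by \<open>B\<close>. The row enters the exponents through \<open>h = 1 / ln m\<close>, which is
  replaced by the smaller \<open>1 / ln k\<close>; the Chernoff rate of the second event is \<open>h powr a\<close>.
\<close>
definition exceptional_bound :: "real \<Rightarrow> real \<Rightarrow> nat \<Rightarrow> real" where
  "exceptional_bound B a k = (1 + real k * B) * exp (- (real k / (12 * (B + 1) * ln (real k))))
           + exp (- (real k / (2 * ln (real k) powr (a + 1))))"

lemma summable_powr_exceptional_bound:
  fixes A B a :: real
  assumes "A > 0" "B \<ge> 1" "a > 0"
  shows "summable (\<lambda>k. real k powr A * exceptional_bound B a k)"
proof -
  \<comment> \<open>a single constant of known sign, so that the expansion need not determine the sign of \<open>B + 1\<close>\<close>
  define c where "c = 12 * (B + 1)"
  have c: "c > 0" using assms by (simp add: c_def)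
  have "(\<lambda>k::nat. real k powr A * ((1 + real k * B) * exp (- (real k / (c * ln (real k))))
           + exp (- (real k / (2 * ln (real k) powr (a + 1)))))) \<in> O(\<lambda>k. real k powr (-2))"
    using assms c by real_asymp
  moreover have "summable (\<lambda>k. real k powr (-2))" by (simp add: summable_real_powr_iff)
  ultimately show ?thesis unfolding exceptional_bound_def c_def using summable_comparison_test_bigo[of "\<lambda>k. real k powr (-2)"] by simp
qed

lemma integrable_if_nn_integral_le:
  fixes f :: "'b \<Rightarrow> real"
  assumes [measurable]: "f \<in> borel_measurable N" and "\<And>x. 0 \<le> f x"
    and le: "(\<integral>\<^sup>+ x. ennreal (f x) \<partial>N) \<le> ennreal C" and "0 \<le> C"
  shows "integrable N f" and "(LINT x|N. f x) \<le> C"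
proof -
  show int: "integrable N f"
    using le assms(2) by (intro integrableI_nonneg) (auto intro: le_less_trans)
  have "ennreal (LINT x|N. f x) \<le> ennreal C"
    using le by (subst nn_integral_eq_integral[symmetric]) (use int assms(2) in auto)
  then show "(LINT x|N. f x) \<le> C" using \<open>0 \<le> C\<close> by simp
qed

text \<open>
  All powers of \<open>\<bar>x - \<theta>\<bar>\<close> of order at most \<open>2 + \<delta>\<close> lie below one function \<open>g\<close> that is affine in
  \<open>\<bar>x\<bar> powr (2 + \<delta>)\<close>, so the single constant bounding the integral of \<open>g\<close> serves for both moments.
\<close>
lemma uniform_moment_bound:
  fixes \<theta> \<delta> q :: real
  assumes "\<delta> > 0" and q: "0 < q" "q \<le> \<delta> / 2"
    and bdd: "uniformly_bounded_moment (2 + \<delta>) \<P>"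
    and prob: "\<And>P. P \<in> \<P> \<Longrightarrow> prob_space P" "\<And>P. P \<in> \<P> \<Longrightarrow> sets P = sets borel"
  obtains B where "B \<ge> 1"
    and "\<And>P. P \<in> \<P> \<Longrightarrow> integrable P (\<lambda>x. (x - \<theta>)\<^sup>2)"
    and "\<And>P. P \<in> \<P> \<Longrightarrow> (LINT x|P. (x - \<theta>)\<^sup>2) \<le> B"
    and "\<And>P. P \<in> \<P> \<Longrightarrow> integrable P (\<lambda>x. ((x - \<theta>)\<^sup>2) powr (1 + q))"
    and "\<And>P. P \<in> \<P> \<Longrightarrow> (LINT x|P. ((x - \<theta>)\<^sup>2) powr (1 + q)) \<le> B"
proof -
  let ?r = "2 + \<delta>"
  define K where "K = enn2real (SUP P\<in>\<P>. \<integral>\<^sup>+ x. ennreal (\<bar>x\<bar> powr ?r) \<partial>P)"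
  have K: "(\<integral>\<^sup>+ x. ennreal (\<bar>x\<bar> powr ?r) \<partial>P) \<le> ennreal K" if "P \<in> \<P>" for P
  proof -
    have "(\<integral>\<^sup>+ x. ennreal (\<bar>x\<bar> powr ?r) \<partial>P) \<le> (SUP P\<in>\<P>. \<integral>\<^sup>+ x. ennreal (\<bar>x\<bar> powr ?r) \<partial>P)"
      using that by (rule SUP_upper)
    also have "\<dots> = ennreal K"
      using bdd by (simp add: K_def uniformly_bounded_moment_def)
    finally show ?thesis .
  qed
  have K_nonneg: "K \<ge> 0" by (simp add: K_def)
  define B where "B = 1 + 2 powr ?r * (\<bar>\<theta>\<bar> powr ?r + K)"
  have B: "B \<ge> 1" using K_nonneg by (simp add: B_def)
  define g where "g x = 1 + 2 powr ?r * (\<bar>\<theta>\<bar> powr ?r + \<bar>x\<bar> powr ?r)" for x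
  have ge: "\<bar>x - \<theta>\<bar> powr p \<le> g x" if p: "0 < p" "p \<le> ?r" for p x
  proof -
    have "\<bar>x - \<theta>\<bar> powr p \<le> 1 + \<bar>x - \<theta>\<bar> powr ?r"
    proof (cases "\<bar>x - \<theta>\<bar> \<le> 1")
      case True
      then have "\<bar>x - \<theta>\<bar> powr p \<le> 1" using p by (simp add: powr_le1)
      then show ?thesis by (simp add: add_increasing2)
    next
      case False
      then have "\<bar>x - \<theta>\<bar> powr p \<le> \<bar>x - \<theta>\<bar> powr ?r" by (intro powr_mono p(2)) simp
      then show ?thesis by linarith
    qed
    also have "\<bar>x - \<theta>\<bar> powr ?r \<le> (2 * max \<bar>\<theta>\<bar> \<bar>x\<bar>) powr ?r"
      using \<open>\<delta> > 0\<close> by (intro powr_mono2) auto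
    also have "\<dots> \<le> 2 powr ?r * (\<bar>\<theta>\<bar> powr ?r + \<bar>x\<bar> powr ?r)"
      unfolding powr_mult by (intro mult_left_mono) (auto simp: max_def)
    finally show ?thesis by (simp add: g_def)
  qed
  have Eg: "(\<integral>\<^sup>+ x. ennreal (g x) \<partial>P) \<le> ennreal B" if P: "P \<in> \<P>" for P
  proof -
    interpret P: prob_space P using prob(1)[OF P] .
    note [measurable_cong] = prob(2)[OF P]
    have "(\<integral>\<^sup>+ x. ennreal (g x) \<partial>P)
        = (\<integral>\<^sup>+ x. ennreal (1 + 2 powr ?r * \<bar>\<theta>\<bar> powr ?r) + ennreal (2 powr ?r) * ennreal (\<bar>x\<bar> powr ?r) \<partial>P)"
      by (intro nn_integral_cong) (simp add: g_def ennreal_mult[symmetric] ennreal_plus[symmetric] algebra_simps del: ennreal_plus)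
    also have "\<dots> = ennreal (1 + 2 powr ?r * \<bar>\<theta>\<bar> powr ?r) + ennreal (2 powr ?r) * (\<integral>\<^sup>+ x. ennreal (\<bar>x\<bar> powr ?r) \<partial>P)"
      by (simp add: nn_integral_add nn_integral_cmult P.emeasure_space_1 del: ennreal_plus)
    also have "\<dots> \<le> ennreal (1 + 2 powr ?r * \<bar>\<theta>\<bar> powr ?r) + ennreal (2 powr ?r) * ennreal K"
      by (intro add_left_mono mult_left_mono K P) auto
    also have "\<dots> = ennreal B"
      using K_nonneg by (simp add: B_def ennreal_mult[symmetric] ennreal_plus[symmetric] algebra_simps del: ennreal_plus)
    finally show ?thesis .
  qed
  have *: "integrable P (\<lambda>x. \<bar>x - \<theta>\<bar> powr p)" "(LINT x|P. \<bar>x - \<theta>\<bar> powr p) \<le> B"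
    if P: "P \<in> \<P>" and p: "0 < p" "p \<le> ?r" for P p
  proof -
    note [measurable_cong] = prob(2)[OF P]
    have "(\<integral>\<^sup>+ x. ennreal (\<bar>x - \<theta>\<bar> powr p) \<partial>P) \<le> (\<integral>\<^sup>+ x. ennreal (g x) \<partial>P)"
      by (intro nn_integral_mono ennreal_leI ge p)
    also note Eg[OF P]
    finally have le: "(\<integral>\<^sup>+ x. ennreal (\<bar>x - \<theta>\<bar> powr p) \<partial>P) \<le> ennreal B" .
    have meas: "(\<lambda>x. \<bar>x - \<theta>\<bar> powr p) \<in> borel_measurable P" by measurable
    show "integrable P (\<lambda>x. \<bar>x - \<theta>\<bar> powr p)" "(LINT x|P. \<bar>x - \<theta>\<bar> powr p) \<le> B"
      using integrable_if_nn_integral_le[OF meas _ le] B by auto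
  qed
  have two: "(x - \<theta>)\<^sup>2 = \<bar>x - \<theta>\<bar> powr 2" for x
    by (cases "x = \<theta>") (simp_all add: powr_numeral)
  have pq: "((x - \<theta>)\<^sup>2) powr (1 + q) = \<bar>x - \<theta>\<bar> powr (2 * (1 + q))" for x
    unfolding two powr_powr ..
  show ?thesis
  proof (rule that[OF B])
    fix P assume P: "P \<in> \<P>"
    have "0 < (2::real)" "2 \<le> ?r" "0 < 2 * (1 + q)" "2 * (1 + q) \<le> ?r" using q \<open>\<delta> > 0\<close> by auto
    then show "integrable P (\<lambda>x. (x - \<theta>)\<^sup>2)" "(LINT x|P. (x - \<theta>)\<^sup>2) \<le> B"
      "integrable P (\<lambda>x. ((x - \<theta>)\<^sup>2) powr (1 + q))" "(LINT x|P. ((x - \<theta>)\<^sup>2) powr (1 + q)) \<le> B"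
      unfolding pq unfolding two by (blast intro: *[OF P])+
  qed
qed

lemma suminf_shift_tendsto_0:
  fixes f :: "nat \<Rightarrow> real"
  assumes "summable f"
  shows "(\<lambda>m. \<Sum>k. f (k + m)) \<longlonglongrightarrow> 0"
proof -
  have "(\<lambda>m. suminf f - (\<Sum>k<m. f k)) \<longlonglongrightarrow> suminf f - suminf f"
    by (intro tendsto_diff tendsto_const summable_LIMSEQ assms)
  then show ?thesis by (simp add: suminf_minus_initial_segment[OF assms])
qed

theorem proposition4p4:
  fixes \<theta> \<delta> \<gamma> :: real
    and \<P> :: "real measure set"
    and \<Omega> :: "'a measure"
    and \<M> :: "real measure \<Rightarrow> 'a measure"
    and X :: "nat \<Rightarrow> 'a \<Rightarrow> real"
    and T :: "nat \<Rightarrow> real"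
    and F :: "real measure"
  assumes "\<delta> > 0"
    and "\<P> \<subseteq> mean_moment_class (2 + \<delta>) \<theta>"
    and "uniformly_bounded_moment (2 + \<delta>) \<P>"
    and "\<And>P. P \<in> \<P> \<Longrightarrow> sets (\<M> P) = sets \<Omega>"
    and "\<And>P. P \<in> \<P> \<Longrightarrow> iid_with_law (\<M> P) X P"
    and "0 < \<gamma>" and "\<gamma> < 1 / 2"
    and "\<And>n. T n \<ge> 0"
    and "T \<in> o(\<lambda>n. real n powr (\<delta> * \<gamma> / 2) / ln (real n) powr (2 + \<delta> / 2))"
    and "prob_space F" and "sets F = sets borel"
  shows "uniform_asymptotic_e_process (natural_filtration (space \<Omega>) X) \<M> \<P>
           (truncated_mixture X F T \<theta>)"
  unfolding uniform_asymptotic_e_process_def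
proof (intro allI impI)
  fix \<tau> :: "'a \<Rightarrow> nat"
  assume \<tau>: "stopping_time (natural_filtration (space \<Omega>) X) \<tau>"
  define A where "A = \<delta> * \<gamma> / 2"
  have A: "A > 0" using assms(1,6) by (simp add: A_def)
  \<comment> \<open>\<open>q \<le> 1\<close> is what the Laplace transform estimate admits, and \<open>2 (1 + q) \<le> 2 + \<delta>\<close> moments exist\<close>
  define q where "q = min 1 (\<delta> / 2)"
  have q: "0 < q" "q \<le> 1" "q \<le> \<delta> / 2" using assms(1) by (auto simp: q_def)
  define a where "a = 2 / q"
  have a: "a > 0" using q by (simp add: a_def)
  have prob: "prob_space P" "sets P = sets borel" if "P \<in> \<P>" for P
    using that assms(2) by (auto simp: mean_moment_class_def)
  obtain B where B: "B \<ge> 1"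
    and int2: "\<And>P. P \<in> \<P> \<Longrightarrow> integrable P (\<lambda>x. (x - \<theta>)\<^sup>2)"
    and le2: "\<And>P. P \<in> \<P> \<Longrightarrow> (LINT x|P. (x - \<theta>)\<^sup>2) \<le> B"
    and intq: "\<And>P. P \<in> \<P> \<Longrightarrow> integrable P (\<lambda>x. ((x - \<theta>)\<^sup>2) powr (1 + q))"
    and leq: "\<And>P. P \<in> \<P> \<Longrightarrow> (LINT x|P. ((x - \<theta>)\<^sup>2) powr (1 + q)) \<le> B"
    using uniform_moment_bound[OF assms(1) q(1,3) assms(3) prob] by metis
  define f where "f k = real k powr A * exceptional_bound B a k" for k
  have sum_f: "summable f"
    unfolding f_def by (rule summable_powr_exceptional_bound[OF A B a])
  have bad_nonneg: "exceptional_bound B a k \<ge> 0" for k using B by (simp add: exceptional_bound_def)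
  have ev_T: "\<forall>\<^sub>F m in sequentially. T m \<le> real m powr A"
  proof -
    have "\<forall>\<^sub>F m in sequentially. norm (T m) \<le> 1 * norm (real m powr A / ln (real m) powr (2 + \<delta> / 2))"
      unfolding A_def by (rule landau_o.smallD[OF assms(9)]) simp
    moreover have "\<forall>\<^sub>F m in sequentially. ln (real m) \<ge> 1" by real_asymp
    ultimately show ?thesis
    proof eventually_elim
      case (elim m)
      have "1 \<le> ln (real m) powr (2 + \<delta> / 2)"
        using elim(2) assms(1) by (intro ge_one_powr_ge_zero) auto
      then have "real m powr A / ln (real m) powr (2 + \<delta> / 2) \<le> real m powr A / 1"
        by (intro divide_left_mono) auto
      with elim(1) show ?case by simp
    qed
  qed
  have ev_h: "\<forall>\<^sub>F m in sequentially. B / ln (real m) \<le> 1 / 2" by real_asymp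
  have ev_1: "\<forall>\<^sub>F m in sequentially. ln (real m) \<ge> 1" by real_asymp
  have "\<forall>\<^sub>F m in sequentially. (SUP P\<in>\<P>. \<integral>\<^sup>+ \<omega>. truncated_mixture X F T \<theta> m (max (\<tau> \<omega>) m) \<omega> \<partial>(\<M> P))
      \<le> 1 + ennreal (\<Sum>k. f (k + m))"
    using ev_T ev_h ev_1 eventually_ge_at_top[of 2]
  proof eventually_elim
    case (elim m)
    define h where "h = 1 / ln (real m)"
    \<comment> \<open>with \<open>a q = 2\<close> the error term \<open>s powr (1 + q) * B\<close> is \<open>s * h * (B * h)\<close>, below half of the gain \<open>s * h\<close>\<close>
    define s where "s = h powr a"
    \<comment> \<open>the largest value that the comparison with the empirical variance admits for all variances up to \<open>B\<close>\<close>
    define \<eta> where "\<eta> = h / (3 * (B + 1))"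
    have h: "0 < h" "h \<le> 1" "B * h \<le> 1 / 2" using elim by (auto simp: h_def)
    have s: "s > 0" using h by (simp add: s_def)
    have \<eta>: "0 \<le> \<eta>" "\<eta> \<le> 2" using h B by (auto simp: \<eta>_def field_simps)
    have sq: "s powr (1 + q) * B \<le> s * h / 2"
    proof -
      have "s powr q = h powr 2" unfolding s_def powr_powr a_def using q by simp
      then have "s powr (1 + q) * B = s * h * (B * h)"
        using s h by (simp add: powr_add powr_numeral power2_eq_square)
      also have "\<dots> \<le> s * h * (1 / 2)" using s h by (intro mult_left_mono) auto
      finally show ?thesis by simp
    qed
    show ?case
    proof (rule SUP_least)
      fix P assume P: "P \<in> \<P>"
      interpret iid_square_integrable "\<M> P" X P \<theta> "LINT x|P. (x - \<theta>)\<^sup>2"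
        using P assms(2,5) int2 by unfold_locales (auto simp: mean_moment_class_def)
      let ?v = "LINT x|P. (x - \<theta>)\<^sup>2"
      have space: "space (\<M> P) = space \<Omega>" using assms(4)[OF P] by (rule sets_eq_imp_space_eq)
      have bad: "(1 + real k * ?v) * exp (- (\<eta> * real k / 4))
          + exp (- (real k * (s * h - s powr (1 + q) * B))) \<le> exceptional_bound B a k" if k: "k \<ge> m" for k
        unfolding exceptional_bound_def
      proof (rule add_mono[OF mult_mono])
        have ln: "1 \<le> ln (real m)" "ln (real m) \<le> ln (real k)"
          using elim k by (auto intro!: ln_mono)
        have h_ge: "1 / ln (real k) \<le> h" unfolding h_def using ln by (intro divide_left_mono) auto
        show "1 + real k * ?v \<le> 1 + real k * B" using le2[OF P] by (simp add: mult_left_mono)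
        have "real k / (12 * (B + 1) * ln (real k)) = (1 / ln (real k)) * (real k / (12 * (B + 1)))" by simp
        also have "\<dots> \<le> h * (real k / (12 * (B + 1)))" using B h_ge by (intro mult_right_mono) auto
        also have "\<dots> = \<eta> * real k / 4" using B by (simp add: \<eta>_def field_simps)
        finally show "exp (- (\<eta> * real k / 4)) \<le> exp (- (real k / (12 * (B + 1) * ln (real k))))" by simp
        have "real k / (2 * ln (real k) powr (a + 1)) = real k / 2 * (1 / ln (real k)) powr (a + 1)"
          using ln by (simp add: powr_divide)
        also have "\<dots> \<le> real k / 2 * h powr (a + 1)"
          using h_ge ln a by (intro mult_left_mono powr_mono2) auto
        also have "\<dots> = real k * (s * h / 2)" using h by (simp add: s_def powr_add)
        also have "\<dots> \<le> real k * (s * h - s powr (1 + q) * B)"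
        proof (rule mult_left_mono)
          show "s * h / 2 \<le> s * h - s powr (1 + q) * B" using sq by linarith
        qed simp
        finally show "exp (- (real k * (s * h - s powr (1 + q) * B)))
            \<le> exp (- (real k / (2 * ln (real k) powr (a + 1))))" by simp
      qed (use B in auto)
      have "(\<integral>\<^sup>+ \<omega>. truncated_mixture X F T \<theta> m (max (\<tau> \<omega>) m) \<omega> \<partial>(\<M> P))
          \<le> 1 + ennreal (T m) * (\<Sum>k. ennreal ((1 + real (k + m) * ?v) * exp (- (\<eta> * real (k + m) / 4))
          + exp (- (real (k + m) * (s * h - s powr (1 + q) * B)))))"
      proof (rule nn_integral_truncated_mixture_le[OF assms(10,11) _ _ h_def _ \<eta>])
        show "stopping_time (natural_filtration (space (\<M> P)) X) \<tau>" using \<tau> by (simp add: space)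
        have "\<eta> * (?v + 1) \<le> \<eta> * (B + 1)" using \<eta> le2[OF P] by (intro mult_left_mono) auto
        also have "\<eta> * (B + 1) = h / 3" using B by (simp add: \<eta>_def field_simps)
        finally show "\<eta> * (?v + 1) \<le> h / 3" .
      qed (use elim h s q intq[OF P] leq[OF P] in auto)
      also have "\<dots> \<le> 1 + ennreal (real m powr A) * (\<Sum>k. ennreal (exceptional_bound B a (k + m)))"
        using elim by (intro add_left_mono mult_mono suminf_le ennreal_leI bad) auto
      also have "\<dots> = 1 + (\<Sum>k. ennreal (real m powr A) * ennreal (exceptional_bound B a (k + m)))" by simp
      also have "\<dots> \<le> 1 + (\<Sum>k. ennreal (f (k + m)))"
      proof (intro add_left_mono suminf_le)
        fix k
        have "real m powr A * exceptional_bound B a (k + m) \<le> f (k + m)"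
          unfolding f_def using A by (intro mult_right_mono powr_mono2 bad_nonneg) auto
        then show "ennreal (real m powr A) * ennreal (exceptional_bound B a (k + m)) \<le> ennreal (f (k + m))"
          by (simp add: ennreal_mult[symmetric] bad_nonneg ennreal_leI)
      qed auto
      also have "(\<Sum>k. ennreal (f (k + m))) = ennreal (\<Sum>k. f (k + m))"
      proof (rule suminf_ennreal2)
        show "summable (\<lambda>k. f (k + m))" using sum_f by (simp only: summable_iff_shift)
      qed (simp add: f_def bad_nonneg)
      finally show "(\<integral>\<^sup>+ \<omega>. truncated_mixture X F T \<theta> m (max (\<tau> \<omega>) m) \<omega> \<partial>(\<M> P))
          \<le> 1 + ennreal (\<Sum>k. f (k + m))" .
    qed
  qed
  then have "limsup (\<lambda>m. SUP P\<in>\<P>. \<integral>\<^sup>+ \<omega>. truncated_mixture X F T \<theta> m (max (\<tau> \<omega>) m) \<omega> \<partial>(\<M> P))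
      \<le> limsup (\<lambda>m. 1 + ennreal (\<Sum>k. f (k + m)))"
    by (rule Limsup_mono)
  also have "\<dots> = 1"
  proof (rule lim_imp_Limsup)
    have "(\<lambda>m. 1 + ennreal (\<Sum>k. f (k + m))) \<longlonglongrightarrow> 1 + ennreal 0"
      by (intro tendsto_add tendsto_const tendsto_ennrealI suminf_shift_tendsto_0 sum_f)
    then show "(\<lambda>m. 1 + ennreal (\<Sum>k. f (k + m))) \<longlonglongrightarrow> 1" by simp
  qed simp
  finally show "limsup (\<lambda>m. SUP P\<in>\<P>. \<integral>\<^sup>+ \<omega>. truncated_mixture X F T \<theta> m (max (\<tau> \<omega>) m) \<omega> \<partial>(\<M> P)) \<le> 1" .
qed

end
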